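(* The class $\mathrm{Av}(1324)$ is contained in the descending $(\mathrm{Av}(213),\mathrm{Av}(132))$ staircase.
   Context: A permutation $\sigma=\sigma(1)\ldots\sigma(n)$ contains a permutation $\pi$ of length $k$ if some subsequence of $\sigma$ of length $k$ is order isomorphic to $\pi$; otherwise $\sigma$ avoids $\pi$. $\mathrm{Av}(\pi)$ is the set of all permutations avoiding $\pi$; it is a permutation class (closed under taking contained permutations). Grid classes. Let $M$ be a $t\times u$ matrix of (possibly empty) permutation classes, with $t$ columns and $u$ rows; $M_{k,\ell}$ is the entry in column $k$ (columns numbered from left to right) and row $\ell$ (rows numbered from bottom to top, following increasing values). An $M$-gridding of a permutation $\sigma$ of length $n$ is a pair of sequences $1=c_1\le\dots\le c_{t+1}=n+1$ (column dividers) and $1=r_1\le\dots\le r_{u+1}=n+1$ (row dividers) such that for all $k\in\{1,\dots,t\}$ and $\ell\in\{1,\dots,u\}$ the entries of $\sigma$ whose indices are in $[c_k,c_{k+1})$ and whose values are in $[r_\ell,r_{\ell+1})$ are order isomorphic to an element of $M_{k,\ell}$; a cell containing the empty permutation class contains no entries. $\mathrm{Grid}(M)$ is the set of permutations having an $M$-gridding. If $M$ is an infinite matrix, $\mathrm{Grid}(M)$ is the set of permutations that have an $M'$-gridding for some finite submatrix $M'$ of $M$. Staircases. Given permutation classes $\mathcal C$ and $\mathcal D$, the descending $(\mathcal C,\mathcal D)$ staircase is the infinite grid class of the matrix whose columns are numbered $1,2,3,\dots$ from left to right and whose rows are here numbered $1,2,3,\dots$ from top to bottom, with $\mathcal C$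 in column $i$, row $i$ (the diagonal) and $\mathcal D$ in column $i$, row $i+1$ (directly below, the subdiagonal) for each $i\ge1$, and the empty permutation class in all other cells. *)

theory Defs
  imports "HOL-Library.Sublist"
begin

text \<open>Permutations of length \<open>n\<close> are given in one-line notation, as lists containing each of
  \<open>1, \<dots>, n\<close> exactly once; the empty list is the permutation of length \<open>0\<close>.\<close>

definition permutation :: "nat list \<Rightarrow> bool" where
  "permutation \<sigma> \<longleftrightarrow> distinct \<sigma> \<and> set \<sigma> = {1..length \<sigma>}"

definition order_isomorphic :: "nat list \<Rightarrow> nat list \<Rightarrow> bool" where
  "order_isomorphic xs ys \<longleftrightarrow> length xs = length ys \<and>
     (\<forall>i<length xs. \<forall>j<length xs. xs ! i < xs ! j \<longleftrightarrow> ys ! i < ys ! j)"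

definition contains :: "nat list \<Rightarrow> nat list \<Rightarrow> bool" where
  "contains \<sigma> \<pi> \<longleftrightarrow> (\<exists>xs. subseq xs \<sigma> \<and> order_isomorphic xs \<pi>)"

definition Av :: "nat list \<Rightarrow> nat list set" where
  "Av \<pi> = {\<sigma>. permutation \<sigma> \<and> \<not> contains \<sigma> \<pi>}"

text \<open>Indices, values, columns and rows are numbered from 1, whereas list positions start at 0.
  The argument \<open>M\<close> of the following definitions is indexed by column first; only its entries with
  column in \<open>{1..t}\<close> (left to right) and row in \<open>{1..u}\<close> (bottom to top) matter.\<close>

definition cell :: "nat list \<Rightarrow> (nat \<Rightarrow> nat) \<Rightarrow> (nat \<Rightarrow> nat) \<Rightarrow> nat \<Rightarrow> nat \<Rightarrow> nat list" where
  "cell \<sigma> c r k l =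
     filter (\<lambda>v. v \<in> {r l..<r (l + 1)}) (nths \<sigma> {i. i + 1 \<in> {c k..<c (k + 1)}})"

definition dividers :: "nat \<Rightarrow> nat \<Rightarrow> (nat \<Rightarrow> nat) \<Rightarrow> bool" where
  "dividers n t c \<longleftrightarrow> c 1 = 1 \<and> (\<forall>k\<in>{1..t}. c k \<le> c (k + 1)) \<and> c (t + 1) = n + 1"

text \<open>A cell whose class is the empty set must be treated separately: it is required to contain
  no entries, although the empty list is not order isomorphic to a member of the empty set.\<close>

definition gridding ::
  "nat \<Rightarrow> nat \<Rightarrow> (nat \<Rightarrow> nat \<Rightarrow> nat list set) \<Rightarrow> nat list \<Rightarrow> (nat \<Rightarrow> nat) \<Rightarrow> (nat \<Rightarrow> nat) \<Rightarrow> bool" where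
  "gridding t u M \<sigma> c r \<longleftrightarrow>
     dividers (length \<sigma>) t c \<and> dividers (length \<sigma>) u r \<and>
     (\<forall>k\<in>{1..t}. \<forall>l\<in>{1..u}.
        if M k l = {} then cell \<sigma> c r k l = []
        else \<exists>\<tau>\<in>M k l. order_isomorphic (cell \<sigma> c r k l) \<tau>)"

definition Grid :: "nat \<Rightarrow> nat \<Rightarrow> (nat \<Rightarrow> nat \<Rightarrow> nat list set) \<Rightarrow> nat list set" where
  "Grid t u M = {\<sigma>. permutation \<sigma> \<and> (\<exists>c r. gridding t u M \<sigma> c r)}"

text \<open>Here \<open>M\<close> is an infinite matrix with columns \<open>1, 2, \<dots>\<close> from left to right and rows
  \<open>1, 2, \<dots>\<close> from \<^emph>\<open>top to bottom\<close>. A finite submatrix keeps columns \<open>a 1 < \<dots> < a t\<close> and, since the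
  rows of a finite matrix are numbered from the bottom, rows \<open>b 1 > \<dots> > b u\<close> of \<open>M\<close>.\<close>

definition Grid_infinite :: "(nat \<Rightarrow> nat \<Rightarrow> nat list set) \<Rightarrow> nat list set" where
  "Grid_infinite M =
     {\<sigma>. \<exists>t u a b. 1 \<le> t \<and> 1 \<le> u \<and>
        strict_mono_on {1..t} a \<and> a ` {1..t} \<subseteq> {1..} \<and>
        strict_antimono_on {1..u} b \<and> b ` {1..u} \<subseteq> {1..} \<and>
        \<sigma> \<in> Grid t u (\<lambda>k l. M (a k) (b l))}"

definition staircase_matrix ::
  "nat list set \<Rightarrow> nat list set \<Rightarrow> nat \<Rightarrow> nat \<Rightarrow> nat list set" where
  "staircase_matrix C D i j = (if j = i then C else if j = i + 1 then D else {})"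

definition descending_staircase :: "nat list set \<Rightarrow> nat list set \<Rightarrow> nat list set" where
  "descending_staircase C D = Grid_infinite (staircase_matrix C D)"

end

theory Submission
  imports Defs
begin

text \<open>The gridding of a 1324-avoider \<open>\<sigma>\<close> is found greedily, by lines that are drawn alternately.
  A row line is drawn as low as it can be while the entries above it and to the right of the
  previous column line avoid 213. The next column line is drawn as far to the right as it can be
  while the entries to its left and below that row line avoid 132. Thus each diagonal cell avoids
  213 and each subdiagonal cell avoids 132.

  All other cells are empty because each line is extremal. If a column line is not at the
  right end, moving it one step further would create a 132 to its left and below the row line; an
  entry above the row line and to the right of the column line would play the 4 of a 1324. This
  empties the cells above the diagonal (\<open>no_entry_northeast\<close>). Likewise, if a row line is not at
  the bottom, moving it one step further down would create a 213 above it and to the right of the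
  column line; an entry below the row line and to the left of the column line would play the 1 of
  a 1324. This empties the cells below the subdiagonal (\<open>no_entry_southwest\<close>).

  The latter fact also shows that the process ends: to the left of a column line there is nothing
  below the next row line, so the next column line can always advance by at least one entry. After
  \<open>n\<close> steps, where \<open>n\<close> is the length of \<open>\<sigma>\<close>, every entry is covered.\<close>

section \<open>Order isomorphism and containment\<close>

lemma order_isomorphic_length: "order_isomorphic xs ys \<Longrightarrow> length xs = length ys"
  by (simp add: order_isomorphic_def)

lemma order_isomorphic_trans:
  "order_isomorphic xs ys \<Longrightarrow> order_isomorphic ys zs \<Longrightarrow> order_isomorphic xs zs"
  by (simp add: order_isomorphic_def)

lemma order_isomorphic_map:
  assumes "\<And>v w. v \<in> set xs \<Longrightarrow> w \<in> set xs \<Longrightarrow> f v < f w \<longleftrightarrow> v < w"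
  shows "order_isomorphic xs (map f xs)"
  using assms by (simp add: order_isomorphic_def)

lemma order_isomorphic_append_max:
  assumes "order_isomorphic xs ys" and "\<forall>x\<in>set xs. x < v" and "\<forall>y\<in>set ys. y < w"
  shows "order_isomorphic (xs @ [v]) (ys @ [w])"
proof -
  have len: "length ys = length xs"
    using assms(1) by (simp add: order_isomorphic_def)
  have iso: "xs ! i < xs ! j \<longleftrightarrow> ys ! i < ys ! j" if "i < length xs" "j < length xs" for i j
    using assms(1) that by (simp add: order_isomorphic_def)
  have "xs ! i < v" "ys ! i < w" "\<not> v < xs ! i" "\<not> w < ys ! i" if "i < length xs" for i
    using assms(2,3) that len by (simp_all add: not_less less_imp_le)
  then show ?thesis
    by (auto simp: order_isomorphic_def nth_append len iso less_Suc_eq)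
qed

lemma order_isomorphic_Cons_min:
  assumes "order_isomorphic xs ys" and "\<forall>x\<in>set xs. v < x" and "\<forall>y\<in>set ys. w < y"
  shows "order_isomorphic (v # xs) (w # ys)"
proof -
  have len: "length ys = length xs"
    using assms(1) by (simp add: order_isomorphic_def)
  have iso: "xs ! i < xs ! j \<longleftrightarrow> ys ! i < ys ! j" if "i < length xs" "j < length xs" for i j
    using assms(1) that by (simp add: order_isomorphic_def)
  have "v < xs ! i" "w < ys ! i" "\<not> xs ! i < v" "\<not> ys ! i < w" if "i < length xs" for i
    using assms(2,3) that len by (simp_all add: not_less less_imp_le)
  then show ?thesis
    by (auto simp: order_isomorphic_def nth_Cons len iso split: nat.split)
qed

lemma set_subseq: "subseq xs ys \<Longrightarrow> set xs \<subseteq> set ys"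
  by (metis set_nths_subset subseq_conv_nths)

lemma contains_subseq: "contains xs \<pi> \<Longrightarrow> subseq xs ys \<Longrightarrow> contains ys \<pi>"
  unfolding contains_def using subseq_order.order_trans by blast

lemma contains_length: "contains xs \<pi> \<Longrightarrow> length \<pi> \<le> length xs"
  unfolding contains_def using list_emb_length order_isomorphic_length by metis

lemma contains_filter_drop:
  assumes "contains (filter P (drop m (take k \<sigma>))) \<pi>" and "\<And>v. P v \<Longrightarrow> Q v"
  shows "contains (filter Q (drop m \<sigma>)) \<pi>"
proof -
  have "subseq (drop m (take k \<sigma>)) (drop m \<sigma>)"
    by (simp add: drop_take prefix_imp_subseq take_is_prefix)
  moreover have "filter P (drop m (take k \<sigma>)) = filter P (filter Q (drop m (take k \<sigma>)))"
    using assms(2) by (auto intro: filter_cong)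
  ultimately show ?thesis
    using assms(1) contains_subseq subseq_filter_left subseq_filter by metis
qed

lemma contains_filter_take:
  assumes "contains (filter P (drop m (take k \<sigma>))) \<pi>" and "\<And>v. P v \<Longrightarrow> Q v"
  shows "contains (filter Q (take k \<sigma>)) \<pi>"
proof -
  have "subseq (drop m (take k \<sigma>)) (take k \<sigma>)"
    by (simp add: suffix_drop suffix_imp_subseq)
  moreover have "filter P (drop m (take k \<sigma>)) = filter P (filter Q (drop m (take k \<sigma>)))"
    using assms(2) by (auto intro: filter_cong)
  ultimately show ?thesis
    using assms(1) contains_subseq subseq_filter_left subseq_filter by metis
qed

lemma map_subseqE:
  assumes "subseq ys (map f xs)"
  obtains zs where "subseq zs xs" "ys = map f zs"
  using assms by (metis nths_map subseq_conv_nths)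

text \<open>Replacing each entry by its rank turns a cell into a permutation; this is what membership of
  a cell in a class amounts to.\<close>

lemma order_isomorphic_Av:
  assumes "distinct xs" and "\<not> contains xs \<pi>"
  shows "\<exists>\<tau>\<in>Av \<pi>. order_isomorphic xs \<tau>"
proof -
  define rank where "rank v = card {w \<in> set xs. w \<le> v}" for v
  have less: "rank v < rank w" if "v < w" "w \<in> set xs" for v w
  proof -
    have "w \<in> {u \<in> set xs. u \<le> w} - {u \<in> set xs. u \<le> v}" using that by simp
    moreover have "{u \<in> set xs. u \<le> v} \<subseteq> {u \<in> set xs. u \<le> w}" using that by auto
    ultimately show ?thesis unfolding rank_def by (intro psubset_card_mono) auto
  qed
  have rank_iff: "rank v < rank w \<longleftrightarrow> v < w" if "v \<in> set xs" "w \<in> set xs" for v w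
    using less that by (metis less_asym linorder_neqE_nat less_irrefl)
  have inj: "inj_on rank (set xs)"
    by (rule inj_onI) (metis rank_iff linorder_neqE_nat less_irrefl)
  have "rank ` set xs = {1..length xs}"
  proof (rule card_subset_eq)
    have "1 \<le> rank v" if "v \<in> set xs" for v
      unfolding rank_def using that by (simp add: Suc_le_eq card_gt_0_iff) blast
    moreover have "rank v \<le> length xs" for v
      unfolding rank_def using distinct_card[OF assms(1)]
      by (metis (no_types, lifting) List.finite_set card_mono mem_Collect_eq subsetI)
    ultimately show "rank ` set xs \<subseteq> {1..length xs}" by auto
    show "card (rank ` set xs) = card {1..length xs}"
      by (simp add: card_image inj distinct_card assms(1))
  qed simp
  then have "permutation (map rank xs)"
    by (simp add: permutation_def distinct_map inj assms(1))
  moreover have "\<not> contains (map rank xs) \<pi>"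
  proof
    assume "contains (map rank xs) \<pi>"
    then obtain zs where zs: "subseq zs xs" "order_isomorphic (map rank zs) \<pi>"
      unfolding contains_def by (metis map_subseqE)
    have "order_isomorphic zs (map rank zs)"
      using set_subseq[OF zs(1)] by (intro order_isomorphic_map rank_iff) auto
    with zs assms(2) show False
      unfolding contains_def using order_isomorphic_trans by blast
  qed
  ultimately show ?thesis
    unfolding Av_def using order_isomorphic_map[of xs rank] rank_iff by blast
qed

text \<open>The empty permutation is a member. Hence the cells of the staircase that have to be empty are
  exactly those off the diagonal and the subdiagonal.\<close>

lemma Av_nonempty: "\<pi> \<noteq> [] \<Longrightarrow> Av \<pi> \<noteq> {}"
  using contains_length[of "[]" \<pi>] order_isomorphic_Av[of "[]" \<pi>] by fastforce

section \<open>The greedy lines\<close>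

text \<open>The column line \<open>x\<close> has the first \<open>x\<close> entries to its left, and the row line \<open>y\<close> has the values
  below \<open>y\<close> under it.\<close>

definition lowest_row_line :: "nat list \<Rightarrow> nat \<Rightarrow> nat" where
  "lowest_row_line \<sigma> x =
     (LEAST y. 1 \<le> y \<and> \<not> contains (filter (\<lambda>v. y \<le> v) (drop x \<sigma>)) [2, 1, 3])"

definition rightmost_col_line :: "nat list \<Rightarrow> nat \<Rightarrow> nat" where
  "rightmost_col_line \<sigma> y =
     (GREATEST x. x \<le> length \<sigma> \<and> \<not> contains (filter (\<lambda>v. v < y) (take x \<sigma>)) [1, 3, 2])"

primrec col_line :: "nat list \<Rightarrow> nat \<Rightarrow> nat" where
  "col_line \<sigma> 0 = 0"
| "col_line \<sigma> (Suc i) = rightmost_col_line \<sigma> (lowest_row_line \<sigma> (col_line \<sigma> i))"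

primrec row_line :: "nat list \<Rightarrow> nat \<Rightarrow> nat" where
  "row_line \<sigma> 0 = length \<sigma> + 1"
| "row_line \<sigma> (Suc i) = lowest_row_line \<sigma> (col_line \<sigma> i)"

lemma not_contains_Nil: "\<not> contains [] (p # \<pi>)"
  using contains_length by fastforce

lemma rightmost_col_line:
  shows rightmost_col_line_le_length: "rightmost_col_line \<sigma> y \<le> length \<sigma>"
    and rightmost_col_line_avoids:
      "\<not> contains (filter (\<lambda>v. v < y) (take (rightmost_col_line \<sigma> y) \<sigma>)) [1, 3, 2]"
proof -
  let ?P = "\<lambda>x. x \<le> length \<sigma> \<and> \<not> contains (filter (\<lambda>v. v < y) (take x \<sigma>)) [1, 3, 2]"
  have "?P 0" by (simp add: not_contains_Nil)
  then have "?P (GREATEST x. ?P x)"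
    by (rule GreatestI_nat[where b = "length \<sigma>"]) simp
  then show "rightmost_col_line \<sigma> y \<le> length \<sigma>"
    and "\<not> contains (filter (\<lambda>v. v < y) (take (rightmost_col_line \<sigma> y) \<sigma>)) [1, 3, 2]"
    by (simp_all add: rightmost_col_line_def)
qed

lemma rightmost_col_line_greatest:
  assumes "x \<le> length \<sigma>" and "\<not> contains (filter (\<lambda>v. v < y) (take x \<sigma>)) [1, 3, 2]"
  shows "x \<le> rightmost_col_line \<sigma> y"
  unfolding rightmost_col_line_def
  by (rule Greatest_le_nat[where b = "length \<sigma>"]) (use assms in auto)

lemma rightmost_col_line_antimono:
  assumes "y' \<le> y"
  shows "rightmost_col_line \<sigma> y \<le> rightmost_col_line \<sigma> y'"
proof (rule rightmost_col_line_greatest)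
  show "rightmost_col_line \<sigma> y \<le> length \<sigma>"
    by (rule rightmost_col_line_le_length)
  show "\<not> contains (filter (\<lambda>v. v < y') (take (rightmost_col_line \<sigma> y) \<sigma>)) [1, 3, 2]"
    using rightmost_col_line_avoids[of y \<sigma>] assms
      contains_filter_take[of "\<lambda>v. v < y'" 0 "rightmost_col_line \<sigma> y" \<sigma> "[1, 3, 2]" "\<lambda>v. v < y"]
    by fastforce
qed

context
  fixes \<sigma> :: "nat list"
  assumes perm: "permutation \<sigma>"
begin

lemma set_perm: "set \<sigma> = {1..length \<sigma>}"
  and distinct_perm: "distinct \<sigma>"
  using perm by (auto simp: permutation_def)

lemma no_value_above: "filter (\<lambda>v. length \<sigma> + 1 \<le> v) (drop x \<sigma>) = []"
  using set_perm by (auto simp: filter_empty_conv dest: in_set_dropD)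

lemma lowest_row_line:
  shows lowest_row_line_ge_1: "1 \<le> lowest_row_line \<sigma> x"
    and lowest_row_line_avoids:
      "\<not> contains (filter (\<lambda>v. lowest_row_line \<sigma> x \<le> v) (drop x \<sigma>)) [2, 1, 3]"
proof -
  let ?P = "\<lambda>y. 1 \<le> y \<and> \<not> contains (filter (\<lambda>v. y \<le> v) (drop x \<sigma>)) [2, 1, 3]"
  have "?P (length \<sigma> + 1)"
    unfolding no_value_above by (simp add: not_contains_Nil)
  then have "?P (LEAST y. ?P y)" by (rule LeastI)
  then show "1 \<le> lowest_row_line \<sigma> x"
    and "\<not> contains (filter (\<lambda>v. lowest_row_line \<sigma> x \<le> v) (drop x \<sigma>)) [2, 1, 3]"
    by (simp_all add: lowest_row_line_def)
qed

lemma lowest_row_line_least: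
  assumes "1 \<le> y" and "\<not> contains (filter (\<lambda>v. y \<le> v) (drop x \<sigma>)) [2, 1, 3]"
  shows "lowest_row_line \<sigma> x \<le> y"
  unfolding lowest_row_line_def by (rule Least_le) (use assms in auto)

lemma lowest_row_line_le: "lowest_row_line \<sigma> x \<le> length \<sigma> + 1"
  by (rule lowest_row_line_least, simp, unfold no_value_above, rule not_contains_Nil)

lemma lowest_row_line_antimono:
  assumes "x \<le> x'"
  shows "lowest_row_line \<sigma> x' \<le> lowest_row_line \<sigma> x"
proof (rule lowest_row_line_least)
  have "subseq (drop x' \<sigma>) (drop x \<sigma>)"
    using assms by (metis drop_drop le_add_diff_inverse2 suffix_drop suffix_imp_subseq)
  then show "\<not> contains (filter (\<lambda>v. lowest_row_line \<sigma> x \<le> v) (drop x' \<sigma>)) [2, 1, 3]"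
    using lowest_row_line_avoids contains_subseq subseq_filter by metis
qed (rule lowest_row_line_ge_1)

lemma col_line_le_length: "col_line \<sigma> i \<le> length \<sigma>"
  by (cases i) (simp_all add: rightmost_col_line_le_length)

lemma col_line_Suc: "col_line \<sigma> i \<le> col_line \<sigma> (Suc i)"
proof (induction i)
  case (Suc i)
  then show ?case
    by (simp add: lowest_row_line_antimono rightmost_col_line_antimono)
qed simp

lemma col_line_mono: "i \<le> j \<Longrightarrow> col_line \<sigma> i \<le> col_line \<sigma> j"
  by (rule lift_Suc_mono_le[of "col_line \<sigma>"]) (rule col_line_Suc)

lemma row_line_Suc: "row_line \<sigma> (Suc i) \<le> row_line \<sigma> i"
  by (cases i) (use lowest_row_line_le lowest_row_line_antimono[OF col_line_Suc] in auto)

lemma row_line_antimono: "i \<le> j \<Longrightarrow> row_line \<sigma> j \<le> row_line \<sigma> i"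
  by (rule lift_Suc_antimono_le[of "row_line \<sigma>"]) (rule row_line_Suc)

section \<open>Empty cells\<close>

context
  assumes av: "\<not> contains \<sigma> [1, 3, 2, 4]"
begin

text \<open>An entry above \<open>y\<close> and to the right of the line would be the 4 of a 1324 whose 132 appears when
  the line is moved one step to the right.\<close>

lemma no_entry_northeast_of_col_line:
  assumes p: "rightmost_col_line \<sigma> y \<le> p" "p < length \<sigma>"
  shows "\<sigma> ! p < y"
proof (rule ccontr)
  assume "\<not> \<sigma> ! p < y"
  then have high: "y \<le> \<sigma> ! p" by simp
  define x where "x = rightmost_col_line \<sigma> y"
  have len: "x < length \<sigma>" using p by (simp add: x_def)
  have occ: "contains (filter (\<lambda>v. v < y) (take (Suc x) \<sigma>)) [1, 3, 2]"
    using rightmost_col_line_greatest[of "Suc x" \<sigma> y] len by (auto simp: x_def)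
  have take_Suc: "take (Suc x) \<sigma> = take x \<sigma> @ [\<sigma> ! x]"
    using len by (rule take_Suc_conv_app_nth)
  \<comment> \<open>The entry just right of the line completes the 132, so it lies below \<open>y\<close> and is not the
    entry at \<open>p\<close>.\<close>
  have "\<sigma> ! x < y"
  proof (rule ccontr)
    assume "\<not> \<sigma> ! x < y"
    then have "filter (\<lambda>v. v < y) (take (Suc x) \<sigma>) = filter (\<lambda>v. v < y) (take x \<sigma>)"
      by (simp add: take_Suc)
    with occ rightmost_col_line_avoids[of y \<sigma>] show False
      unfolding x_def by simp
  qed
  with high p(1) have "Suc x \<le> p"
    by (metis Suc_leI le_neq_implies_less not_le x_def)
  then have "\<sigma> ! p \<in> set (drop (Suc x) \<sigma>)"
    using p(2) by (auto simp: in_set_conv_nth intro!: exI[of _ "p - Suc x"])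
  then have four: "subseq [\<sigma> ! p] (drop (Suc x) \<sigma>)"
    by (simp add: subseq_singleton_left)
  obtain xs where xs: "subseq xs (filter (\<lambda>v. v < y) (take (Suc x) \<sigma>))"
      "order_isomorphic xs [1, 3, 2]"
    using occ by (auto simp: contains_def)
  have "\<forall>v\<in>set xs. v < y"
    using set_subseq[OF xs(1)] by auto
  then have "order_isomorphic (xs @ [\<sigma> ! p]) ([1, 3, 2] @ [4])"
    using high xs(2) by (intro order_isomorphic_append_max) auto
  moreover have "subseq (xs @ [\<sigma> ! p]) \<sigma>"
    using list_emb_append_mono[OF subseq_order.order_trans[OF xs(1) subseq_filter_left] four]
    by simp
  ultimately show False using av by (auto simp: contains_def)
qed

text \<open>An entry below the line and to the left of \<open>x\<close> would be the 1 of a 1324 whose 213 appears when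
  the line is moved one step down.\<close>

lemma no_entry_southwest_of_row_line:
  assumes p: "p < x" "p < length \<sigma>"
  shows "lowest_row_line \<sigma> x \<le> \<sigma> ! p"
proof (rule ccontr)
  define y where "y = lowest_row_line \<sigma> x"
  assume "\<not> lowest_row_line \<sigma> x \<le> \<sigma> ! p"
  then have low: "\<sigma> ! p < y" by (simp add: y_def)
  have "1 \<le> \<sigma> ! p" using set_perm p(2) nth_mem by fastforce
  then have occ: "contains (filter (\<lambda>v. y - 1 \<le> v) (drop x \<sigma>)) [2, 1, 3]"
    using lowest_row_line_least[of "y - 1" x] low by (fastforce simp: y_def)
  obtain xs where xs: "subseq xs (filter (\<lambda>v. y - 1 \<le> v) (drop x \<sigma>))"
      "order_isomorphic xs [2, 1, 3]"
    using occ by (auto simp: contains_def)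
  have one: "\<sigma> ! p \<in> set (take x \<sigma>)"
    using p by (auto simp: in_set_conv_nth)
  \<comment> \<open>The 213 may use the value \<open>y - 1\<close>, which \<open>\<sigma> ! p\<close> might equal; but it lies right of \<open>x\<close>.\<close>
  have "\<sigma> ! p < v" if "v \<in> set xs" for v
  proof -
    have v: "y - 1 \<le> v" "v \<in> set (drop x \<sigma>)"
      using set_subseq[OF xs(1)] that by auto
    then have "v \<noteq> \<sigma> ! p"
      using one set_take_disj_set_drop_if_distinct[OF distinct_perm, of x x] by blast
    with v low show ?thesis by simp
  qed
  moreover have "order_isomorphic [2, 1, 3] [3, 2, 4]"
    using order_isomorphic_map[of "[2, 1, 3]" Suc] by (simp add: numeral_eq_Suc)
  ultimately have "order_isomorphic (\<sigma> ! p # xs) (1 # [3, 2, 4])"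
    using xs(2) by (intro order_isomorphic_Cons_min) (auto intro: order_isomorphic_trans)
  moreover have "subseq ([\<sigma> ! p] @ xs) (take x \<sigma> @ drop x \<sigma>)"
    using one subseq_order.order_trans[OF xs(1) subseq_filter_left]
    by (intro list_emb_append_mono) (simp_all add: subseq_singleton_left)
  ultimately show False using av by (auto simp: contains_def)
qed

lemma no_entry_northeast:
  assumes "col_line \<sigma> i \<le> p" "p < length \<sigma>"
  shows "\<sigma> ! p < row_line \<sigma> i"
proof (cases i)
  case 0
  then show ?thesis using assms(2) set_perm nth_mem by fastforce
next
  case (Suc j)
  then show ?thesis using assms no_entry_northeast_of_col_line by simp
qed

lemma no_entry_southwest:
  assumes "p < col_line \<sigma> i" "p < length \<sigma>"
  shows "row_line \<sigma> (Suc i) \<le> \<sigma> ! p"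
  using assms no_entry_southwest_of_row_line by simp

section \<open>The greedy lines reach the end\<close>

text \<open>Below the next row line there is nothing to the left of the column line, so one more entry
  cannot create a 132.\<close>

lemma col_line_progress:
  assumes "col_line \<sigma> i < length \<sigma>"
  shows "col_line \<sigma> i < col_line \<sigma> (Suc i)"
proof -
  let ?x = "col_line \<sigma> i" and ?y = "row_line \<sigma> (Suc i)"
  have "filter (\<lambda>v. v < ?y) (take ?x \<sigma>) = []"
    using no_entry_southwest by (fastforce simp: filter_empty_conv in_set_conv_nth)
  then have "length (filter (\<lambda>v. v < ?y) (take (Suc ?x) \<sigma>)) \<le> 1"
    using assms by (simp add: take_Suc_conv_app_nth)
  then have "\<not> contains (filter (\<lambda>v. v < ?y) (take (Suc ?x) \<sigma>)) [1, 3, 2]"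
    using contains_length by fastforce
  then show ?thesis
    using rightmost_col_line_greatest[of "Suc ?x" \<sigma> ?y] assms by simp
qed

lemma col_line_ge: "min i (length \<sigma>) \<le> col_line \<sigma> i"
proof (induction i)
  case (Suc i)
  show ?case
    using Suc col_line_progress[of i] col_line_Suc[of i] by linarith
qed simp

lemma col_line_end: "length \<sigma> \<le> i \<Longrightarrow> col_line \<sigma> i = length \<sigma>"
  using col_line_ge[of i] col_line_le_length[of i] by simp

lemma row_line_end: "row_line \<sigma> (Suc (length \<sigma>)) = 1"
proof -
  have "lowest_row_line \<sigma> (length \<sigma>) \<le> 1"
    by (rule lowest_row_line_least) (simp_all add: not_contains_Nil)
  then show ?thesis
    using lowest_row_line_ge_1[of "length \<sigma>"] by (simp add: col_line_end)
qed

section \<open>The gridding\<close>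

text \<open>One row and column more than the length of the permutation are taken: after \<open>n\<close> steps the
  column line is at the right end, and the row line drawn from there has nothing to its right, so
  it falls to the bottom.\<close>

lemma gridding_greedy:
  defines "t \<equiv> Suc (length \<sigma>)"
  shows "gridding t t
    (\<lambda>k l. staircase_matrix (Av [2, 1, 3]) (Av [1, 3, 2]) k (Suc t - l)) \<sigma>
    (\<lambda>k. Suc (col_line \<sigma> (k - 1))) (\<lambda>l. row_line \<sigma> (Suc t - l))"
    (is "gridding t t ?M \<sigma> ?c ?r")
  unfolding gridding_def
proof (intro conjI ballI)
  show "dividers (length \<sigma>) t ?c"
    by (auto simp: dividers_def t_def col_line_mono col_line_end simp del: col_line.simps(2))
  show "dividers (length \<sigma>) t ?r"
    by (auto simp: dividers_def t_def row_line_antimono row_line_end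
        simp del: row_line.simps(2))
  fix k l assume k: "k \<in> {1..t}" and l: "l \<in> {1..t}"
  \<comment> \<open>The row \<open>l\<close> from the bottom is the row \<open>Suc j\<close> from the top.\<close>
  define j where "j = t - l"
  obtain i where i: "k = Suc i" using k by (cases k) auto
  have j: "Suc t - l = Suc j" using l by (auto simp: j_def)
  have "nths \<sigma> {p. p + 1 \<in> {?c k..<?c (k + 1)}} =
      drop (col_line \<sigma> i) (take (col_line \<sigma> (Suc i)) \<sigma>)"
  proof -
    let ?a = "col_line \<sigma> i" and ?b = "col_line \<sigma> (Suc i)"
    have "{p. p + 1 \<in> {?c k..<?c (k + 1)}} = (+) ?a ` {..<?b - ?a}"
      by (auto simp: i image_iff simp del: col_line.simps dest!: le_Suc_ex)
    then show ?thesis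
      by (simp add: drop_take flip: nths_drop del: col_line.simps)
  qed
  then have cell: "cell \<sigma> ?c ?r k l =
      filter (\<lambda>v. v \<in> {row_line \<sigma> (Suc j)..<row_line \<sigma> j})
        (drop (col_line \<sigma> i) (take (col_line \<sigma> (Suc i)) \<sigma>))" (is "_ = ?cell")
    by (simp add: cell_def j j_def del: col_line.simps row_line.simps)
  have M: "?M k l = staircase_matrix (Av [2, 1, 3]) (Av [1, 3, 2]) (Suc i) (Suc j)"
    by (simp add: i j)
  have distinct_cell: "distinct ?cell" by (simp add: distinct_perm)
  have entry: "\<exists>p\<ge>col_line \<sigma> i. p < col_line \<sigma> (Suc i) \<and> p < length \<sigma> \<and> v = \<sigma> ! p"
    if v: "v \<in> set (drop (col_line \<sigma> i) (take (col_line \<sigma> (Suc i)) \<sigma>))" for v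
  proof -
    obtain q where "q < length (drop (col_line \<sigma> i) (take (col_line \<sigma> (Suc i)) \<sigma>))"
        "v = drop (col_line \<sigma> i) (take (col_line \<sigma> (Suc i)) \<sigma>) ! q"
      using v by (metis in_set_conv_nth)
    then show ?thesis
      by (intro exI[of _ "col_line \<sigma> i + q"]) (simp add: less_diff_conv add.commute del: col_line.simps)
  qed
  consider (diagonal) "j = i" | (subdiagonal) "j = Suc i" | (above) "j < i" | (below) "Suc i < j"
    by linarith
  then show "if ?M k l = {} then cell \<sigma> ?c ?r k l = []
      else \<exists>\<tau>\<in>?M k l. order_isomorphic (cell \<sigma> ?c ?r k l) \<tau>"
  proof cases
    case diagonal
    have "\<not> contains ?cell [2, 1, 3]"
      using contains_filter_drop[where Q = "\<lambda>v. row_line \<sigma> (Suc i) \<le> v"]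
        lowest_row_line_avoids[of "col_line \<sigma> i"] diagonal by fastforce
    then show ?thesis
      unfolding cell M
      using order_isomorphic_Av[OF distinct_cell] diagonal
      by (simp add: staircase_matrix_def Av_nonempty del: col_line.simps row_line.simps)
  next
    case subdiagonal
    have "\<not> contains ?cell [1, 3, 2]"
      using contains_filter_take[where Q = "\<lambda>v. v < row_line \<sigma> (Suc i)"]
        rightmost_col_line_avoids[of "row_line \<sigma> (Suc i)" \<sigma>] subdiagonal by fastforce
    then show ?thesis
      unfolding cell M
      using order_isomorphic_Av[OF distinct_cell] subdiagonal
      by (simp add: staircase_matrix_def Av_nonempty del: col_line.simps row_line.simps)
  next
    case above
    have "\<sigma> ! p < row_line \<sigma> (Suc j)" if "col_line \<sigma> i \<le> p" "p < length \<sigma>" for p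
      using no_entry_northeast[OF that] row_line_antimono[of "Suc j" i] above by linarith
    then have "?cell = []"
      unfolding filter_empty_conv by (metis entry atLeastLessThan_iff not_le)
    then show ?thesis
      unfolding cell M
      using above by (simp add: staircase_matrix_def del: col_line.simps row_line.simps)
  next
    case below
    have "row_line \<sigma> j \<le> \<sigma> ! p" if "p < col_line \<sigma> (Suc i)" "p < length \<sigma>" for p
      using no_entry_southwest[OF that] row_line_antimono[of "Suc (Suc i)" j] below by linarith
    then have "?cell = []"
      unfolding filter_empty_conv by (metis entry atLeastLessThan_iff not_le)
    then show ?thesis
      unfolding cell M
      using below by (simp add: staircase_matrix_def del: col_line.simps row_line.simps)
  qed
qed

end

end

theorem proposition2p1:
  "Av [1, 3, 2, 4] \<subseteq> descending_staircase (Av [2, 1, 3]) (Av [1, 3, 2])"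
proof
  fix \<sigma> assume "\<sigma> \<in> Av [1, 3, 2, 4]"
  then have \<sigma>: "permutation \<sigma>" "\<not> contains \<sigma> [1, 3, 2, 4]" by (simp_all add: Av_def)
  let ?t = "Suc (length \<sigma>)"
  let ?M = "staircase_matrix (Av [2, 1, 3]) (Av [1, 3, 2])"
  have "\<sigma> \<in> Grid ?t ?t (\<lambda>k l. ?M (id k) (Suc ?t - l))"
    using gridding_greedy[OF \<sigma>] \<sigma>(1) unfolding Grid_def by auto
  moreover have "strict_mono_on {1..?t} id" "id ` {1..?t} \<subseteq> {1..}"
    by (auto simp: strict_mono_on_def)
  moreover have "strict_antimono_on {1..?t} (\<lambda>l. Suc ?t - l)" "(\<lambda>l. Suc ?t - l) ` {1..?t} \<subseteq> {1..}"
    by (auto simp: monotone_on_def)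
  ultimately show "\<sigma> \<in> descending_staircase (Av [2, 1, 3]) (Av [1, 3, 2])"
    unfolding descending_staircase_def Grid_infinite_def mem_Collect_eq
    by (intro exI[of _ ?t] exI[of _ id] exI[of _ "\<lambda>l. Suc ?t - l"]) simp
qed

end
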